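(* Let $F=F(\theta,\phi)$ be a smooth positive function on $\mathbb{S}^2$, and let $\Sigma$ be the surface in the Minkowski space $\mathbb{R}^{3,1}$ determined, in the usual spherical coordinates $(t,r,\theta,\phi)$, by the equation $$t=r=F(\theta,\phi),\qquad(\theta,\phi)\in\mathbb{S}^2 .$$ Then $\Sigma$ is acausal, and consequently $\Sigma$ spans a compact spacelike hypersurface in $\mathbb{R}^{3,1}$.
   Context: Two points $p$ and $q$ in a Lorentzian manifold $N$ are said to be causally related if they can be joined by a timelike or null path in $N$. A set $S\subset N$ is called acausal if no two distinct points of $S$ are causally related. "$\Sigma$ spans a hypersurface" means that $\Sigma$ is the boundary of that hypersurface. These surfaces are the examples of Ó Murchadha, Szabados and Tod, lying on the light cone of $\mathbb{R}^{3,1}$. *)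

theory Defs
  imports "HOL-Analysis.Analysis"
begin

section \<open>Smooth maps\<close>

text \<open>\<open>Ck_on k f U\<close> and \<open>Cinf_on U f\<close> are meant for open \<open>U\<close> only: the derivatives are
  two-sided.\<close>

fun Ck_on :: "nat \<Rightarrow> ('a::euclidean_space \<Rightarrow> 'b::euclidean_space) \<Rightarrow> 'a set \<Rightarrow> bool" where
  "Ck_on 0 f U \<longleftrightarrow> continuous_on U f"
| "Ck_on (Suc k) f U \<longleftrightarrow>
     (\<forall>x\<in>U. f differentiable (at x)) \<and>
     (\<forall>v. Ck_on k (\<lambda>x. frechet_derivative f (at x) v) U)"

definition Cinf_on :: "'a::euclidean_space set \<Rightarrow> ('a \<Rightarrow> 'b::euclidean_space) \<Rightarrow> bool" where
  "Cinf_on U f \<longleftrightarrow> (\<forall>k. Ck_on k f U)"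

text \<open>Smoothness on an arbitrary subset, in particular on an embedded submanifold such as the unit
  sphere: local extendability to a smooth function on an open set of the ambient space.\<close>

definition smooth_on :: "'a::euclidean_space set \<Rightarrow> ('a \<Rightarrow> 'b::euclidean_space) \<Rightarrow> bool" where
  "smooth_on S f \<longleftrightarrow>
     (\<forall>p\<in>S. \<exists>U g. open U \<and> p \<in> U \<and> Cinf_on U g \<and> (\<forall>x\<in>U \<inter> S. g x = f x))"

definition diffeomorphism ::
  "'a::euclidean_space set \<Rightarrow> 'b::euclidean_space set \<Rightarrow> ('a \<Rightarrow> 'b) \<Rightarrow> ('b \<Rightarrow> 'a) \<Rightarrow> bool" where
  "diffeomorphism U V \<phi> \<psi> \<longleftrightarrow>
     open U \<and> open V \<and> homeomorphism U V \<phi> \<psi> \<and> Cinf_on U \<phi> \<and> Cinf_on V \<psi>"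


section \<open>Minkowski space and causality\<close>

type_synonym minkowski = "real \<times> (real ^ 3)"

definition eta :: "minkowski \<Rightarrow> minkowski \<Rightarrow> real" where
  "eta v w = snd v \<bullet> snd w - fst v * fst w"

definition timelike :: "minkowski \<Rightarrow> bool" where
  "timelike v \<longleftrightarrow> eta v v < 0"

definition null_vector :: "minkowski \<Rightarrow> bool" where
  "null_vector v \<longleftrightarrow> v \<noteq> 0 \<and> eta v v = 0"

definition spacelike :: "minkowski \<Rightarrow> bool" where
  "spacelike v \<longleftrightarrow> eta v v > 0"

text \<open>Piecewise \<open>C\<^sup>1\<close> paths whose velocity is timelike or null away from finitely many
  parameters. The velocities have to stay in one time cone: for a \<open>C\<^sup>1\<close> path with timelike or
  null velocities this is automatic, but a broken path that reverses its time direction at the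
  corners can join any two points of Minkowski space.\<close>

definition causal_path :: "(real \<Rightarrow> minkowski) \<Rightarrow> bool" where
  "causal_path g \<longleftrightarrow> continuous_on {0..1} g \<and>
     (\<exists>S. finite S \<and> g C1_differentiable_on ({0..1} - S) \<and>
        (\<forall>s\<in>{0..1} - S. timelike (vector_derivative g (at s)) \<or>
                         null_vector (vector_derivative g (at s))) \<and>
        ((\<forall>s\<in>{0..1} - S. fst (vector_derivative g (at s)) > 0) \<or>
         (\<forall>s\<in>{0..1} - S. fst (vector_derivative g (at s)) < 0)))"

definition causally_related :: "minkowski \<Rightarrow> minkowski \<Rightarrow> bool" where
  "causally_related p q \<longleftrightarrow> (\<exists>g. causal_path g \<and> pathstart g = p \<and> pathfinish g = q)"

definition acausal :: "minkowski set \<Rightarrow> bool" where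
  "acausal S \<longleftrightarrow> (\<forall>p\<in>S. \<forall>q\<in>S. p \<noteq> q \<longrightarrow> \<not> causally_related p q)"


section \<open>Hypersurfaces with boundary\<close>

text \<open>Slice charts of the ambient space that straighten \<open>H\<close> to the hyperplane
  \<open>{0} \<times> \<real>\<^sup>3\<close>, respectively to a closed half of it with \<open>p\<close> on the edge.\<close>

definition interior_point :: "minkowski set \<Rightarrow> minkowski \<Rightarrow> bool" where
  "interior_point H p \<longleftrightarrow> p \<in> H \<and>
     (\<exists>U (V :: (real \<times> (real ^ 3)) set) \<phi> \<psi>. p \<in> U \<and> diffeomorphism U V \<phi> \<psi> \<and>
        \<phi> ` (H \<inter> U) = {y\<in>V. fst y = 0})"

definition boundary_point :: "minkowski set \<Rightarrow> minkowski \<Rightarrow> bool" where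
  "boundary_point H p \<longleftrightarrow> p \<in> H \<and>
     (\<exists>U (V :: (real \<times> (real ^ 3)) set) \<phi> \<psi>. p \<in> U \<and> diffeomorphism U V \<phi> \<psi> \<and>
        \<phi> ` (H \<inter> U) = {y\<in>V. fst y = 0 \<and> snd y $ 1 \<ge> 0} \<and> snd (\<phi> p) $ 1 = 0)"

definition hypersurface :: "minkowski set \<Rightarrow> bool" where
  "hypersurface H \<longleftrightarrow> (\<forall>p\<in>H. interior_point H p \<or> boundary_point H p)"

definition hypersurface_boundary :: "minkowski set \<Rightarrow> minkowski set" where
  "hypersurface_boundary H = {p. boundary_point H p}"

text \<open>The curves are one-sided so that the definition also covers boundary points; there their
  velocities only fill a closed half of the tangent space, hence the span.\<close>

definition tangent_space :: "minkowski set \<Rightarrow> minkowski \<Rightarrow> minkowski set" where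
  "tangent_space H p = span {v. \<exists>c. c 0 = p \<and> (\<forall>s\<in>{0..1}. c s \<in> H) \<and>
     (c has_vector_derivative v) (at 0 within {0..1})}"

definition spacelike_hypersurface :: "minkowski set \<Rightarrow> bool" where
  "spacelike_hypersurface H \<longleftrightarrow> hypersurface H \<and>
     (\<forall>p\<in>H. \<forall>v\<in>tangent_space H p. v \<noteq> 0 \<longrightarrow> spacelike v)"

definition spans :: "minkowski set \<Rightarrow> minkowski set \<Rightarrow> bool" where
  "spans S H \<longleftrightarrow> hypersurface_boundary H = S"


section \<open>Surfaces on the light cone\<close>

text \<open>The pair \<open>(\<theta>,\<phi>)\<close> of angular coordinates is represented by the unit vector \<open>\<omega>\<close>
  it describes, so that \<open>(t, r *\<^sub>R \<omega>)\<close> is the point with coordinates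
  \<open>(t,r,\<theta>,\<phi>)\<close>.\<close>

definition light_cone_surface :: "(real ^ 3 \<Rightarrow> real) \<Rightarrow> minkowski set" where
  "light_cone_surface F = {(t, r *\<^sub>R \<omega>) | t r \<omega>. \<omega> \<in> sphere 0 1 \<and> t = r \<and> r = F \<omega>}"

end

theory Submission
  imports Defs
begin

text \<open>
  Acausality. Along a causal path every functional \<open>\<plusminus>t - \<langle>u, x\<rangle>\<close> with \<open>\<bar>u\<bar> \<le> 1\<close> and the sign given by
  the time orientation is nondecreasing, so the displacement between the ends is never spacelike
  (\<open>causal_path_displacement\<close>). Two distinct points \<open>a (1, \<omega>)\<close> and \<open>b (1, \<omega>')\<close> of the surface differ
  by a vector of square \<open>a b \<bar>\<omega> - \<omega>'\<bar>\<^sup>2 > 0\<close>, so no causal path joins them.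

  Spanning. The surface projects to the boundary of the star-shaped body \<open>{x. \<rho> x \<le> 1}\<close> of
  \<open>\<real>\<^sup>3\<close>, where \<open>\<rho> x = \<bar>x\<bar> / F (x / \<bar>x\<bar>)\<close>. Instead of deducing the spanning hypersurface from
  acausality by a general principle, the proof writes one down: the graph over the body of
  \<open>sqrt (\<bar>x\<bar>\<^sup>2 + \<epsilon> b x)\<close>, where \<open>b\<close> is smooth on \<open>\<real>\<^sup>3\<close>, positive inside the body and 0 on its
  boundary. It agrees with the light cone over the boundary, and it is spacelike exactly where
  \<open>\<epsilon> \<bar>\<nabla>b\<bar>\<^sup>2 / 4 < b - \<langle>x, \<nabla>b\<rangle>\<close> (\<open>height_slope\<close>). If \<open>b\<close> is a decreasing function of \<open>\<rho>\<close>,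
  strictly so at \<open>\<rho> = 1\<close>, the right-hand side is positive on the body, and compactness provides a
  suitable \<open>\<epsilon>\<close> (\<open>small_height\<close>). Since \<open>\<rho>\<close> is singular at the origin, \<open>b\<close> is taken constant for
  \<open>\<rho> \<le> 1/2\<close>, by means of the flat function \<open>exp (-1/s)\<close>.

  That this graph is a hypersurface with precisely the given boundary needs explicit charts: a shear
  in the time direction flattens the graph, and near the boundary \<open>\<rho>\<close> together with projective
  coordinates straightens the body (\<open>body_boundary_chart\<close>). Invariance of domain excludes boundary
  charts at the remaining points (\<open>not_boundary_point_graph_over\<close>).
\<close>

section \<open>Calculus of smooth maps\<close>

lemma frechet_derivative_cong_open:
  assumes "open U" "x \<in> U" "\<And>y. y \<in> U \<Longrightarrow> f y = g y"
  shows "frechet_derivative f (at x) = frechet_derivative g (at x)"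
    and "f differentiable (at x) \<longleftrightarrow> g differentiable (at x)"
proof -
  have "(f has_derivative d) (at x) \<longleftrightarrow> (g has_derivative d) (at x)" for d
    using assms has_derivative_transform_within_open[of f d x UNIV U g]
      has_derivative_transform_within_open[of g d x UNIV U f] by auto
  then show "frechet_derivative f (at x) = frechet_derivative g (at x)"
    and "f differentiable (at x) \<longleftrightarrow> g differentiable (at x)"
    by (simp_all add: frechet_derivative_def differentiable_def)
qed

lemma Ck_on_cong:
  assumes "open U" "\<And>x. x \<in> U \<Longrightarrow> f x = g x"
  shows "Ck_on k f U \<longleftrightarrow> Ck_on k g U"
  using assms(2)
proof (induction k arbitrary: f g)
  case 0
  then show ?case by (auto intro: continuous_on_cong)
next
  case (Suc k)
  have "Ck_on k (\<lambda>x. frechet_derivative f (at x) v) U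
      \<longleftrightarrow> Ck_on k (\<lambda>x. frechet_derivative g (at x) v) U" for v
    using frechet_derivative_cong_open(1)[OF assms(1) _ Suc.prems] by (intro Suc.IH) simp
  moreover have "(\<forall>x\<in>U. f differentiable (at x)) \<longleftrightarrow> (\<forall>x\<in>U. g differentiable (at x))"
    using frechet_derivative_cong_open(2)[OF assms(1), of _ f g] Suc.prems by blast
  ultimately show ?case by simp
qed

lemma Ck_on_continuous: "Ck_on k f U \<Longrightarrow> continuous_on U f"
  by (cases k)
    (auto intro!: differentiable_imp_continuous_on differentiable_at_imp_differentiable_on)

lemma Ck_on_Suc_D: "Ck_on (Suc k) f U \<Longrightarrow> Ck_on k f U"
proof (induction k arbitrary: f)
  case 0
  then show ?case using Ck_on_continuous by fastforce
next
  case (Suc k)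
  then show ?case by simp
qed

lemma Ck_on_subset: "Ck_on k f U \<Longrightarrow> V \<subseteq> U \<Longrightarrow> Ck_on k f V"
  by (induction k arbitrary: f) (auto intro: continuous_on_subset)

lemma Ck_on_local:
  assumes "\<And>x. x \<in> U \<Longrightarrow> \<exists>V. open V \<and> x \<in> V \<and> Ck_on k f V"
  shows "Ck_on k f U"
  using assms
proof (induction k arbitrary: f)
  case 0
  have "continuous (at x within U) f" if "x \<in> U" for x
  proof -
    obtain V where "open V" "x \<in> V" "continuous_on V f" using 0[OF \<open>x \<in> U\<close>] by auto
    then show ?thesis
      by (metis continuous_on_eq_continuous_at continuous_at_imp_continuous_at_within)
  qed
  then show ?case by (simp add: continuous_on_eq_continuous_within)
next
  case (Suc k)
  have "Ck_on k (\<lambda>x. frechet_derivative f (at x) v) U" for v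
    using Suc.prems by (intro Suc.IH) fastforce
  then show ?case using Suc.prems by fastforce
qed

text \<open>The working form of the recursion: any explicitly known derivative may replace the
  canonical one.\<close>

lemma Ck_on_SucI:
  assumes "open U" "\<And>x. x \<in> U \<Longrightarrow> (f has_derivative D x) (at x)"
    and "\<And>v. Ck_on k (\<lambda>x. D x v) U"
  shows "Ck_on (Suc k) f U"
proof -
  have "Ck_on k (\<lambda>x. frechet_derivative f (at x) v) U" for v
    using assms(3)[of v] frechet_derivative_at[OF assms(2)]
    by (subst Ck_on_cong[OF assms(1), where g = "\<lambda>x. D x v"]) auto
  then show ?thesis using assms(2) by (auto simp: differentiable_def)
qed

lemma Ck_on_SucD:
  assumes "Ck_on (Suc k) f U" "x \<in> U"
  shows "(f has_derivative frechet_derivative f (at x)) (at x)"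
  using assms by (auto simp: frechet_derivative_works)

lemma Ck_on_const: "Ck_on k (\<lambda>x. c) U"
  by (induction k arbitrary: c) simp_all

lemma Ck_on_add:
  assumes "open U"
  shows "Ck_on k f U \<Longrightarrow> Ck_on k g U \<Longrightarrow> Ck_on k (\<lambda>x. f x + g x) U"
proof (induction k arbitrary: f g)
  case 0
  then show ?case by (auto intro: continuous_intros)
next
  case (Suc k)
  show ?case
    by (rule Ck_on_SucI[OF assms has_derivative_add[OF Ck_on_SucD Ck_on_SucD]])
      (use Suc in auto)
qed

lemma Ck_on_bounded_linear:
  assumes "open U" "bounded_linear L"
  shows "Ck_on k L U"
proof (cases k)
  case 0
  then show ?thesis using assms(2) by (auto intro: linear_continuous_on)
next
  case (Suc k)
  show ?thesis unfolding Suc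
    by (rule Ck_on_SucI[OF assms(1) bounded_linear_imp_has_derivative[OF assms(2)]])
      (rule Ck_on_const)
qed

lemma Ck_on_bilinear:
  assumes "open U" "bounded_bilinear p"
  shows "Ck_on k f U \<Longrightarrow> Ck_on k g U \<Longrightarrow> Ck_on k (\<lambda>x. p (f x) (g x)) U"
proof (induction k arbitrary: f g)
  case 0
  then show ?case using bounded_bilinear.continuous_on[OF assms(2)] by auto
next
  case (Suc k)
  show ?case
  proof (rule Ck_on_SucI[OF assms(1) bounded_bilinear.FDERIV[OF assms(2) Ck_on_SucD Ck_on_SucD]])
    fix v
    have "Ck_on k f U" "Ck_on k g U" using Suc.prems Ck_on_Suc_D by blast+
    then show "Ck_on k (\<lambda>x. p (f x) (frechet_derivative g (at x) v)
        + p (frechet_derivative f (at x) v) (g x)) U"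
      using Suc by (intro Ck_on_add[OF assms(1)] Suc.IH) auto
  qed (use Suc in auto)
qed

lemma Ck_on_sum:
  assumes "open U" "finite I" "\<And>i. i \<in> I \<Longrightarrow> Ck_on k (f i) U"
  shows "Ck_on k (\<lambda>x. \<Sum>i\<in>I. f i x) U"
  using assms(2,3) by (induction I) (auto intro: Ck_on_const Ck_on_add[OF assms(1)])

text \<open>Expanding the inner derivative in a basis turns the chain rule into a finite sum of
  products \<open>\<langle>Dg(x) v, i\<rangle> Df(g x) i\<close>; each factor is of class \<open>C\<^sup>k\<close>, the second one by
  induction.\<close>

lemma Ck_on_compose:
  fixes g :: "'a::euclidean_space \<Rightarrow> 'b::euclidean_space"
    and f :: "'b \<Rightarrow> 'c::euclidean_space"
  assumes "open U" "open V" "g ` U \<subseteq> V"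
  shows "Ck_on k f V \<Longrightarrow> Ck_on k g U \<Longrightarrow> Ck_on k (\<lambda>x. f (g x)) U"
  using assms(3)
proof (induction k arbitrary: f)
  case 0
  then show ?case by (auto intro: continuous_on_compose2)
next
  case (Suc k)
  have gk: "Ck_on k g U" using Suc.prems(2) by (rule Ck_on_Suc_D)
  let ?f = "\<lambda>y. frechet_derivative f (at y)" and ?g = "\<lambda>x. frechet_derivative g (at x)"
  have f: "(f has_derivative ?f (g x)) (at (g x))" if "x \<in> U" for x
    using Ck_on_SucD[OF Suc.prems(1)] Suc.prems(3) that by auto
  show ?case
  proof (rule Ck_on_SucI[OF assms(1)])
    fix x assume "x \<in> U"
    show "((\<lambda>x. f (g x)) has_derivative
        (\<lambda>v. \<Sum>i\<in>Basis. (?g x v \<bullet> i) *\<^sub>R ?f (g x) i)) (at x)"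
    proof (rule has_derivative_eq_rhs)
      show "((\<lambda>x. f (g x)) has_derivative (\<lambda>v. ?f (g x) (?g x v))) (at x)"
        using has_derivative_compose[OF Ck_on_SucD[OF Suc.prems(2) \<open>x \<in> U\<close>] f[OF \<open>x \<in> U\<close>]] .
      show "(\<lambda>v. ?f (g x) (?g x v)) = (\<lambda>v. \<Sum>i\<in>Basis. (?g x v \<bullet> i) *\<^sub>R ?f (g x) i)"
      proof
        fix v
        have lin: "linear (?f (g x))"
          using f[OF \<open>x \<in> U\<close>] has_derivative_linear by blast
        have "?f (g x) (?g x v) = ?f (g x) (\<Sum>i\<in>Basis. (?g x v \<bullet> i) *\<^sub>R i)"
          by (simp add: euclidean_representation)
        then show "?f (g x) (?g x v) = (\<Sum>i\<in>Basis. (?g x v \<bullet> i) *\<^sub>R ?f (g x) i)"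
          by (simp add: linear_sum[OF lin] linear_scale[OF lin])
      qed
    qed
  next
    fix v
    show "Ck_on k (\<lambda>x. \<Sum>i\<in>Basis. (?g x v \<bullet> i) *\<^sub>R ?f (g x) i) U"
    proof (intro Ck_on_sum assms(1) finite_Basis
        Ck_on_bilinear[OF assms(1) bounded_bilinear_scaleR]
        Ck_on_bilinear[OF assms(1) bounded_bilinear_inner] Ck_on_const)
      fix i :: 'b
      show "Ck_on k (\<lambda>x. ?g x v) U" using Suc.prems(2) by simp
      show "Ck_on k (\<lambda>x. ?f (g x) i) U"
        using Suc.prems gk by (intro Suc.IH) auto
    qed
  qed
qed

lemma Ck_on_real_SucI:
  fixes f :: "real \<Rightarrow> real"
  assumes "open U" "\<And>x. x \<in> U \<Longrightarrow> (f has_real_derivative f' x) (at x)" "Ck_on k f' U"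
  shows "Ck_on (Suc k) f U"
  by (rule Ck_on_SucI[OF assms(1) assms(2)[unfolded has_field_derivative_def]])
    (auto intro: Ck_on_bilinear[OF assms(1) bounded_bilinear_mult] assms(3) Ck_on_const)

lemma Ck_on_inverse: "Ck_on k (inverse :: real \<Rightarrow> real) (- {0})"
proof (induction k)
  case 0
  then show ?case by (auto intro: continuous_intros)
next
  case (Suc k)
  show ?case
  proof (rule Ck_on_real_SucI)
    show "(inverse has_real_derivative - 1 * (inverse x * inverse x)) (at x)"
      if "x \<in> - {0}" for x :: real
      using that by (auto intro!: derivative_eq_intros)
    show "Ck_on k (\<lambda>x::real. - 1 * (inverse x * inverse x)) (- {0})"
      by (intro Ck_on_bilinear[OF _ bounded_bilinear_mult] Ck_on_const Suc) auto
  qed auto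
qed

lemma Ck_on_sqrt: "Ck_on k sqrt {0<..}"
proof (induction k)
  case 0
  then show ?case by (auto intro: continuous_intros)
next
  case (Suc k)
  show ?case
  proof (rule Ck_on_real_SucI)
    show "(sqrt has_real_derivative inverse (sqrt x) * (1 / 2)) (at x)" if "x \<in> {0<..}" for x
      using that by (auto intro!: derivative_eq_intros simp: field_simps)
    show "Ck_on k (\<lambda>x. inverse (sqrt x) * (1 / 2)) {0<..}"
      by (intro Ck_on_bilinear[OF _ bounded_bilinear_mult] Ck_on_const
          Ck_on_compose[OF _ _ _ Ck_on_inverse Suc]) auto
  qed auto
qed

lemma Cinf_on_cong:
  "open U \<Longrightarrow> (\<And>x. x \<in> U \<Longrightarrow> f x = g x) \<Longrightarrow> Cinf_on U f \<longleftrightarrow> Cinf_on U g"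
  unfolding Cinf_on_def using Ck_on_cong by blast

lemma Cinf_on_continuous: "Cinf_on U f \<Longrightarrow> continuous_on U f"
  unfolding Cinf_on_def using Ck_on_continuous by blast

lemma Cinf_on_subset: "Cinf_on U f \<Longrightarrow> V \<subseteq> U \<Longrightarrow> Cinf_on V f"
  unfolding Cinf_on_def using Ck_on_subset by blast

lemma Cinf_on_local:
  assumes "\<And>x. x \<in> U \<Longrightarrow> \<exists>V. open V \<and> x \<in> V \<and> Cinf_on V f"
  shows "Cinf_on U f"
  unfolding Cinf_on_def
proof
  fix k
  show "Ck_on k f U"
    using assms unfolding Cinf_on_def by (intro Ck_on_local) blast
qed

lemma Cinf_on_const: "Cinf_on U (\<lambda>x. c)"
  by (simp add: Cinf_on_def Ck_on_const)

lemma Cinf_on_bounded_linear: "open U \<Longrightarrow> bounded_linear L \<Longrightarrow> Cinf_on U L"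
  by (simp add: Cinf_on_def Ck_on_bounded_linear)

lemma Cinf_on_compose:
  assumes "open U" "open V" "Cinf_on V f" "Cinf_on U g" "\<And>x. x \<in> U \<Longrightarrow> g x \<in> V"
  shows "Cinf_on U (\<lambda>x. f (g x))"
proof -
  have "g ` U \<subseteq> V" using assms(5) by blast
  then show ?thesis
    using assms(3,4) Ck_on_compose[OF assms(1,2)] unfolding Cinf_on_def by blast
qed

lemma Cinf_on_linear_compose:
  "open U \<Longrightarrow> bounded_linear L \<Longrightarrow> Cinf_on U f \<Longrightarrow> Cinf_on U (\<lambda>x. L (f x))"
  by (rule Cinf_on_compose[where V = UNIV]) (auto intro: Cinf_on_bounded_linear)

lemma Cinf_on_add:
  "open U \<Longrightarrow> Cinf_on U f \<Longrightarrow> Cinf_on U g \<Longrightarrow> Cinf_on U (\<lambda>x. f x + g x)"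
  by (simp add: Cinf_on_def Ck_on_add)

lemma Cinf_on_scaleR:
  "open U \<Longrightarrow> Cinf_on U f \<Longrightarrow> Cinf_on U g \<Longrightarrow> Cinf_on U (\<lambda>x. f x *\<^sub>R g x)"
  by (simp add: Cinf_on_def Ck_on_bilinear[OF _ bounded_bilinear_scaleR])

lemma Cinf_on_inner:
  "open U \<Longrightarrow> Cinf_on U f \<Longrightarrow> Cinf_on U g \<Longrightarrow> Cinf_on U (\<lambda>x. f x \<bullet> g x)"
  by (simp add: Cinf_on_def Ck_on_bilinear[OF _ bounded_bilinear_inner])

lemma Cinf_on_mult:
  fixes f g :: "'a::euclidean_space \<Rightarrow> real"
  shows "open U \<Longrightarrow> Cinf_on U f \<Longrightarrow> Cinf_on U g \<Longrightarrow> Cinf_on U (\<lambda>x. f x * g x)"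
  using Cinf_on_scaleR[of U f g] by simp

lemma Cinf_on_diff:
  assumes "open U" "Cinf_on U f" "Cinf_on U g"
  shows "Cinf_on U (\<lambda>x. f x - g x)"
  using Cinf_on_add[OF assms(1,2) Cinf_on_scaleR[OF assms(1) Cinf_on_const[of U "-1"] assms(3)]]
  by simp

lemma Cinf_on_inverse:
  fixes f :: "'a::euclidean_space \<Rightarrow> real"
  assumes "open U" "Cinf_on U f" "\<And>x. x \<in> U \<Longrightarrow> f x \<noteq> 0"
  shows "Cinf_on U (\<lambda>x. inverse (f x))"
  by (rule Cinf_on_compose[OF assms(1) _ _ assms(2), of "- {0}"])
    (use assms(3) Ck_on_inverse in \<open>auto simp: Cinf_on_def\<close>)

lemma Cinf_on_sqrt:
  fixes f :: "'a::euclidean_space \<Rightarrow> real"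
  assumes "open U" "Cinf_on U f" "\<And>x. x \<in> U \<Longrightarrow> f x > 0"
  shows "Cinf_on U (\<lambda>x. sqrt (f x))"
  by (rule Cinf_on_compose[OF assms(1) _ _ assms(2), of "{0<..}"])
    (use assms(3) Ck_on_sqrt in \<open>auto simp: Cinf_on_def\<close>)

lemma Cinf_on_Pair:
  assumes "open U" "Cinf_on U f" "Cinf_on U g"
  shows "Cinf_on U (\<lambda>x. (f x, g x))"
proof -
  have "Cinf_on U (\<lambda>x. (f x, 0) + (0, g x))"
    by (intro Cinf_on_add assms Cinf_on_linear_compose[OF assms(1) _ assms(2), of "\<lambda>a. (a, 0)"]
        Cinf_on_linear_compose[OF assms(1) _ assms(3), of "\<lambda>b. (0, b)"]
        bounded_linear_Pair bounded_linear_ident bounded_linear_zero)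
  then show ?thesis by simp
qed

lemma Cinf_on_norm: "Cinf_on (- {0::'a::euclidean_space}) norm"
  unfolding norm_eq_sqrt_inner
  by (intro Cinf_on_sqrt Cinf_on_inner Cinf_on_bounded_linear bounded_linear_ident) auto


section \<open>A smooth function that is flat at the origin\<close>

text \<open>The whole family is needed to get the smoothness of the member \<open>n = 0\<close>: it is closed
  under differentiation up to linear combinations.\<close>

definition flat :: "nat \<Rightarrow> real \<Rightarrow> real" where
  "flat n s = (if s > 0 then exp (- 1 / s) / s ^ n else 0)"

lemma flat_tendsto_0: "(flat n \<longlongrightarrow> 0) (at_right 0)"
proof -
  have "((\<lambda>x. flat n (inverse x)) \<longlongrightarrow> 0) at_top"
  proof (rule tendsto_cong[THEN iffD1])
    show "((\<lambda>x::real. x ^ n / exp x) \<longlongrightarrow> 0) at_top" by (rule tendsto_power_div_exp_0)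
    show "\<forall>\<^sub>F x in at_top. x ^ n / exp x = flat n (inverse x)"
      using eventually_gt_at_top[of "0::real"]
      by eventually_elim (simp add: flat_def exp_minus field_simps)
  qed
  then show ?thesis by (simp add: filterlim_at_right_to_top)
qed

lemma flat_has_derivative:
  "(flat n has_real_derivative flat (n + 2) s - of_nat n * flat (n + 1) s) (at s)"
proof -
  consider "s > 0" | "s < 0" | "s = 0" by linarith
  then show ?thesis
  proof cases
    case 1
    have "real n * s ^ (n - Suc 0) * s = real n * s ^ n"
      by (cases n) simp_all
    then have "((\<lambda>s. exp (- 1 / s) / s ^ n) has_real_derivative
        flat (n + 2) s - of_nat n * flat (n + 1) s) (at s)"
      using 1
      by (auto intro!: derivative_eq_intros simp: flat_def divide_simps power2_eq_square)
        (simp add: algebra_simps)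
    then show ?thesis
      by (rule has_field_derivative_transform_within_open[where S = "{0<..}"])
        (use 1 in \<open>auto simp: flat_def\<close>)
  next
    case 2
    have "((\<lambda>s. 0) has_real_derivative 0) (at s)" by simp
    then have "(flat n has_real_derivative 0) (at s)"
      by (rule has_field_derivative_transform_within_open[where S = "{..<0}"])
        (use 2 in \<open>auto simp: flat_def\<close>)
    then show ?thesis using 2 by (simp add: flat_def)
  next
    case 3
    have "((\<lambda>h. flat n h / h) \<longlongrightarrow> 0) (at_left 0)"
      by (rule tendsto_eventually) (auto simp: flat_def eventually_at_filter)
    moreover have "((\<lambda>h. flat n h / h) \<longlongrightarrow> 0) (at_right 0)"
      using flat_tendsto_0[of "Suc n"]
      by (rule Lim_transform_eventually) (auto simp: flat_def eventually_at_filter)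
    ultimately have "((\<lambda>h. flat n h / h) \<longlongrightarrow> 0) (at 0)"
      by (simp add: filterlim_at_split)
    then show ?thesis using 3 by (simp add: flat_def DERIV_def)
  qed
qed

lemma Ck_on_flat: "Ck_on k (flat n) UNIV"
proof (induction k arbitrary: n)
  case 0
  then show ?case
    using flat_has_derivative by (auto intro!: continuous_at_imp_continuous_on DERIV_isCont)
next
  case (Suc k)
  have "Ck_on k (\<lambda>s. flat (n + 2) s + - real n * flat (n + 1) s) UNIV"
    by (intro Ck_on_add Ck_on_bilinear[OF _ bounded_bilinear_mult] Ck_on_const Suc open_UNIV)
  then show ?case
    by (intro Ck_on_real_SucI[OF _ flat_has_derivative]) (simp_all add: algebra_simps)
qed

lemma flat_0_le_1: "flat 0 s \<le> 1"
  by (simp add: flat_def)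

lemma flat_0_mono: "s \<le> u \<Longrightarrow> flat 0 s \<le> flat 0 u"
  by (auto simp: flat_def frac_le)

lemma flat_0_less_iff: "u > 0 \<Longrightarrow> flat 0 s < flat 0 u \<longleftrightarrow> s < u"
  by (auto simp: flat_def field_simps)


section \<open>Causal paths have causal displacement\<close>

text \<open>A future-directed causal velocity \<open>v\<close> satisfies \<open>fst v \<ge> u \<bullet> snd v\<close> for every \<open>u\<close> in the unit
  ball, so each of these linear functionals increases along the path. The direction \<open>u\<close> of the
  spatial displacement then gives the claim; \<open>\<sigma>\<close> is the time orientation of the path.\<close>

lemma causal_path_displacement:
  assumes "causal_path g"
  shows "eta (g 1 - g 0) (g 1 - g 0) \<le> 0"
proof -
  obtain S where cont: "continuous_on {0..1} g" and "finite S"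
    and C1: "g C1_differentiable_on ({0..1} - S)"
    and causal: "\<And>s. s \<in> {0..1} - S \<Longrightarrow> timelike (vector_derivative g (at s)) \<or>
          null_vector (vector_derivative g (at s))"
    and orient: "(\<forall>s\<in>{0..1} - S. fst (vector_derivative g (at s)) > 0) \<or>
         (\<forall>s\<in>{0..1} - S. fst (vector_derivative g (at s)) < 0)"
    using assms unfolding causal_path_def by blast
  obtain \<sigma> :: real where \<sigma>: "\<bar>\<sigma>\<bar> = 1"
    and pos: "\<And>s. s \<in> {0..1} - S \<Longrightarrow> \<sigma> * fst (vector_derivative g (at s)) > 0"
    using orient that[of 1] that[of "-1"] by auto
  define u where "u = sgn (snd (g 1 - g 0))"
  have u: "norm u \<le> 1" by (simp add: u_def norm_sgn)
  let ?L = "\<lambda>v. \<sigma> * fst v - u \<bullet> snd v"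
  have L: "bounded_linear ?L"
    by (intro bounded_linear_intros)
  have nonneg: "?L (vector_derivative g (at s)) \<ge> 0" if "s \<in> {0..1} - S" for s
  proof -
    let ?v = "vector_derivative g (at s)"
    have "norm (snd ?v) ^ 2 \<le> \<bar>fst ?v\<bar> ^ 2"
      using causal[OF that]
      by (auto simp: timelike_def null_vector_def eta_def dot_square_norm power2_eq_square)
    then have "norm (snd ?v) \<le> \<bar>fst ?v\<bar>"
      by (rule power2_le_imp_le) simp
    moreover have "\<sigma> * fst ?v = \<bar>fst ?v\<bar>"
      using pos[OF that] \<sigma> by (metis abs_mult abs_of_pos mult_1)
    moreover have "u \<bullet> snd ?v \<le> norm (snd ?v)"
      using norm_cauchy_schwarz[of u "snd ?v"] u mult_right_mono[OF u, of "norm (snd ?v)"] by simp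
    ultimately show ?thesis by linarith
  qed
  \<comment> \<open>The velocity is arbitrary on \<open>S\<close>; the value 0 there keeps the integrand nonnegative.\<close>
  define f where "f s = (if s \<in> S then 0 else ?L (vector_derivative g (at s)))" for s
  have "(f has_integral ?L (g 1) - ?L (g 0)) {0..1}"
  proof (rule fundamental_theorem_of_calculus_interior_strong[OF \<open>finite S\<close>])
    show "continuous_on {0..1} (\<lambda>s. ?L (g s))"
      using cont by (intro continuous_intros)
    fix s :: real assume s: "s \<in> {0<..<1} - S"
    then have "(g has_vector_derivative vector_derivative g (at s)) (at s)"
      using C1 by (auto simp: C1_differentiable_on_eq vector_derivative_works)
    then show "((\<lambda>s. ?L (g s)) has_vector_derivative f s) (at s)"
      using bounded_linear.has_vector_derivative[OF L] s by (auto simp: f_def)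
  qed simp
  then have "?L (g 1) - ?L (g 0) \<ge> 0"
    by (rule has_integral_nonneg) (use nonneg in \<open>auto simp: f_def\<close>)
  moreover have "u \<bullet> snd (g 1 - g 0) = norm (snd (g 1 - g 0))"
    by (cases "snd (g 1 - g 0) = 0")
      (simp_all add: u_def sgn_div_norm dot_square_norm power2_eq_square)
  ultimately have "norm (snd (g 1 - g 0)) \<le> \<sigma> * fst (g 1 - g 0)"
    by (simp add: inner_diff_right algebra_simps)
  then have "norm (snd (g 1 - g 0)) ^ 2 \<le> (\<sigma> * fst (g 1 - g 0)) ^ 2"
    by (rule power_mono) simp
  also have "\<dots> = fst (g 1 - g 0) ^ 2"
    using \<sigma> by (metis abs_mult mult_1 power2_abs)
  finally show ?thesis
    unfolding eta_def dot_square_norm power2_eq_square[of "fst _"] by simp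
qed


section \<open>Graphs as hypersurfaces\<close>

definition graph_over :: "(real ^ 3 \<Rightarrow> real) \<Rightarrow> (real ^ 3) set \<Rightarrow> minkowski set" where
  "graph_over h D = (\<lambda>x. (h x, x)) ` D"

text \<open>Shearing along the time axis flattens a graph, so that only its domain still has to be
  straightened, within \<open>\<real>\<^sup>3\<close>.\<close>

lemma graph_over_chart:
  fixes \<Phi> \<Psi> :: "real ^ 3 \<Rightarrow> real ^ 3"
  assumes h: "Cinf_on UNIV h" and diffeo: "diffeomorphism W W' \<Phi> \<Psi>"
    and straight: "\<Phi> ` (D \<inter> W) = {y\<in>W'. P y}"
  defines "\<phi> \<equiv> \<lambda>p. (fst p - h (snd p), \<Phi> (snd p))"
    and "\<psi> \<equiv> \<lambda>q. (fst q + h (\<Psi> (snd q)), \<Psi> (snd q))"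
  shows "diffeomorphism (UNIV \<times> W) (UNIV \<times> W') \<phi> \<psi>"
    and "\<phi> ` (graph_over h D \<inter> UNIV \<times> W) = {q\<in>UNIV \<times> W'. fst q = 0 \<and> P (snd q)}"
proof -
  have "open W" "open W'" and hom: "homeomorphism W W' \<Phi> \<Psi>"
    and C: "Cinf_on W \<Phi>" "Cinf_on W' \<Psi>"
    using diffeo by (auto simp: diffeomorphism_def)
  let ?U = "(UNIV :: real set) \<times> W" and ?V = "(UNIV :: real set) \<times> W'"
  have op: "open ?U" "open ?V"
    using \<open>open W\<close> \<open>open W'\<close> by (auto intro: open_Times)
  have bl: "bounded_linear (fst :: minkowski \<Rightarrow> real)" "bounded_linear (snd :: minkowski \<Rightarrow> real ^ 3)"
    by (rule bounded_linear_fst bounded_linear_snd)+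
  have \<Phi>: "Cinf_on ?U (\<lambda>p. \<Phi> (snd p))"
    by (rule Cinf_on_compose[OF op(1) \<open>open W\<close> C(1) Cinf_on_bounded_linear[OF op(1) bl(2)]]) auto
  have \<Psi>: "Cinf_on ?V (\<lambda>p. \<Psi> (snd p))"
    by (rule Cinf_on_compose[OF op(2) \<open>open W'\<close> C(2) Cinf_on_bounded_linear[OF op(2) bl(2)]]) auto
  have C\<phi>: "Cinf_on ?U \<phi>"
    unfolding \<phi>_def
    by (intro Cinf_on_Pair Cinf_on_diff \<Phi> op Cinf_on_bounded_linear bl
        Cinf_on_compose[OF op(1) open_UNIV h]) auto
  have C\<psi>: "Cinf_on ?V \<psi>"
    unfolding \<psi>_def
    by (intro Cinf_on_Pair Cinf_on_add \<Psi> op Cinf_on_bounded_linear bl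
        Cinf_on_compose[OF op(2) open_UNIV h]) auto
  have inv: "x \<in> W \<Longrightarrow> \<Psi> (\<Phi> x) = x" "y \<in> W' \<Longrightarrow> \<Phi> (\<Psi> y) = y"
    "x \<in> W \<Longrightarrow> \<Phi> x \<in> W'" "y \<in> W' \<Longrightarrow> \<Psi> y \<in> W" for x y
    using hom by (auto simp: homeomorphism_def)
  have "homeomorphism ?U ?V \<phi> \<psi>"
    by (rule homeomorphismI[OF Cinf_on_continuous[OF C\<phi>] Cinf_on_continuous[OF C\<psi>]])
      (auto simp: \<phi>_def \<psi>_def inv)
  then show "diffeomorphism ?U ?V \<phi> \<psi>"
    using op C\<phi> C\<psi> by (simp add: diffeomorphism_def)
  have "\<phi> ` (graph_over h D \<inter> ?U) = Pair 0 ` \<Phi> ` (D \<inter> W)"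
    by (force simp: \<phi>_def graph_over_def image_iff)
  then show "\<phi> ` (graph_over h D \<inter> ?U) = {q\<in>?V. fst q = 0 \<and> P (snd q)}"
    unfolding straight by force
qed

lemma diffeomorphism_id: "open W \<Longrightarrow> diffeomorphism W W id id"
  by (auto simp: diffeomorphism_def homeomorphism_def id_def
      intro: Cinf_on_bounded_linear bounded_linear_ident)

lemma interior_point_graph_over:
  assumes "Cinf_on UNIV h" "x \<in> interior D"
  shows "interior_point (graph_over h D) (h x, x)"
proof -
  have "id ` (D \<inter> interior D) = {y \<in> interior D. True}"
    using interior_subset by auto
  note chart = graph_over_chart[where P = "\<lambda>_. True",
      OF assms(1) diffeomorphism_id[OF open_interior] this, simplified]
  have "(h x, x) \<in> graph_over h D" "(h x, x) \<in> UNIV \<times> interior D"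
    using assms(2) interior_subset by (auto simp: graph_over_def)
  then show ?thesis
    unfolding interior_point_def using chart by (intro conjI exI)
qed

lemma boundary_point_graph_over:
  fixes \<Phi> \<Psi> :: "real ^ 3 \<Rightarrow> real ^ 3"
  assumes "Cinf_on UNIV h" "x \<in> D" "x \<in> W" "diffeomorphism W W' \<Phi> \<Psi>"
    and "\<Phi> ` (D \<inter> W) = {y\<in>W'. y $ 1 \<ge> 0}" "\<Phi> x $ 1 = 0"
  shows "boundary_point (graph_over h D) (h x, x)"
proof -
  define \<phi> where "\<phi> = (\<lambda>p. (fst p - h (snd p), \<Phi> (snd p)))"
  note chart = graph_over_chart[where P = "\<lambda>y. y $ 1 \<ge> 0", OF assms(1,4,5), folded \<phi>_def]
  have "(h x, x) \<in> graph_over h D" "(h x, x) \<in> UNIV \<times> W" "snd (\<phi> (h x, x)) $ 1 = 0"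
    using assms(2,3,6) by (auto simp: graph_over_def \<phi>_def)
  then show ?thesis
    unfolding boundary_point_def using chart by (intro conjI exI)
qed

text \<open>A boundary chart at such a point would map an open subset of \<open>\<real>\<^sup>3\<close> injectively and
  continuously onto a subset of a closed half space that meets the edge, against invariance of
  domain.\<close>

lemma not_boundary_point_graph_over:
  assumes h: "continuous_on UNIV h" and x: "x \<in> interior D"
  shows "\<not> boundary_point (graph_over h D) (h x, x)"
proof
  let ?H = "graph_over h D"
  assume "boundary_point ?H (h x, x)"
  then obtain U V \<phi> \<psi> where xU: "(h x, x) \<in> U"
    and diffeo: "diffeomorphism U (V :: (real \<times> (real ^ 3)) set) \<phi> \<psi>"
    and im: "\<phi> ` (?H \<inter> U) = {y\<in>V. fst y = 0 \<and> snd y $ 1 \<ge> 0}"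
    and edge: "snd (\<phi> (h x, x)) $ 1 = 0"
    unfolding boundary_point_def by blast
  define S where "S = (\<lambda>y. (h y, y)) -` U \<inter> interior D"
  define f where "f y = snd (\<phi> (h y, y))" for y
  have U: "open U" "continuous_on U \<phi>" "inj_on \<phi> U"
    using diffeo by (auto simp: diffeomorphism_def homeomorphism_def intro: inj_on_inverseI)
  have gr: "continuous_on A (\<lambda>y. (h y, y))" for A
    by (intro continuous_intros continuous_on_subset[OF h]) auto
  have "open S"
    unfolding S_def by (intro open_Int open_vimage U gr open_interior)
  have S: "(h y, y) \<in> ?H \<inter> U" if "y \<in> S" for y
    using that interior_subset by (auto simp: S_def graph_over_def)
  have half: "fst (\<phi> (h y, y)) = 0" "f y $ 1 \<ge> 0" if "y \<in> S" for y
    using im S[OF that] unfolding f_def by blast+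
  have "continuous_on S f"
    unfolding f_def
    by (intro continuous_on_snd continuous_on_compose2[OF U(2) gr]) (use S in auto)
  moreover have "inj_on f S"
  proof (rule inj_onI)
    fix y z assume yz: "y \<in> S" "z \<in> S" "f y = f z"
    then have "\<phi> (h y, y) = \<phi> (h z, z)"
      using half by (simp add: f_def prod_eq_iff)
    then show "y = z" using inj_onD[OF U(3)] S yz by blast
  qed
  ultimately have "open (f ` S)"
    using \<open>open S\<close> by (intro invariance_of_domain)
  moreover have "f x \<in> f ` S"
    using x xU by (auto simp: S_def)
  ultimately obtain e where e: "e > 0" "ball (f x) e \<subseteq> f ` S"
    by (auto simp: open_contains_ball)
  have "f x - (e / 2) *\<^sub>R axis 1 1 \<in> ball (f x) e"
    using e(1) by (simp add: dist_norm norm_axis_1)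
  then obtain y where y: "y \<in> S" "f x - (e / 2) *\<^sub>R axis 1 1 = f y"
    using e(2) by blast
  then have "(f x - (e / 2) *\<^sub>R axis 1 1) $ 1 \<ge> 0"
    using half(2)[OF y(1)] by (simp only:)
  then show False
    using e(1) edge[folded f_def] by simp
qed

lemma tangent_space_graph_over:
  assumes h: "(h has_derivative h') (at x)" and v: "v \<in> tangent_space (graph_over h D) (h x, x)"
  shows "fst v = h' (snd v)"
proof -
  have lin: "linear h'" using h has_derivative_linear by blast
  have "subspace {v :: minkowski. fst v = h' (snd v)}"
    by (auto simp: subspace_def linear_0[OF lin] linear_add[OF lin] linear_scale[OF lin])
  moreover have "fst w = h' (snd w)"
    if c: "c 0 = (h x, x)" "\<forall>s\<in>{0..1}. c s \<in> graph_over h D"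
      "(c has_vector_derivative w) (at (0::real) within {0..1})" for c w
  proof -
    have snd: "((\<lambda>s. snd (c s)) has_vector_derivative snd w) (at 0 within {0..1})"
      and fst: "((\<lambda>s. fst (c s)) has_vector_derivative fst w) (at 0 within {0..1})"
      using bounded_linear.has_vector_derivative[OF bounded_linear_snd c(3)]
        bounded_linear.has_vector_derivative[OF bounded_linear_fst c(3)] by auto
    have "((\<lambda>s. h (snd (c s))) has_derivative (\<lambda>s. h' (s *\<^sub>R snd w))) (at 0 within {0..1})"
      using has_derivative_compose[OF snd[unfolded has_vector_derivative_def], of h h'] h c(1) by simp
    then have "((\<lambda>s. h (snd (c s))) has_vector_derivative h' (snd w)) (at 0 within {0..1})"
      by (simp add: has_vector_derivative_def linear_scale[OF lin])
    then have "((\<lambda>s. fst (c s)) has_vector_derivative h' (snd w)) (at 0 within {0..1})"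
    proof (rule has_vector_derivative_transform[rotated 2])
      show "fst (c s) = h (snd (c s))" if "s \<in> {0..1}" for s
        using c(2) that by (force simp: graph_over_def)
    qed simp
    then show ?thesis
      using fst vector_derivative_unique_within_closed_interval[of 0 1 0] by auto
  qed
  ultimately have "tangent_space (graph_over h D) (h x, x) \<subseteq> {v. fst v = h' (snd v)}"
    unfolding tangent_space_def by (intro span_minimal) auto
  then show ?thesis using v by blast
qed


section \<open>The star-shaped body under the surface\<close>

lemma smooth_on_continuous:
  assumes "smooth_on S f"
  shows "continuous_on S f"
  unfolding continuous_on_eq_continuous_within
proof
  fix p assume "p \<in> S"
  then obtain U g where U: "open U" "p \<in> U" "Cinf_on U g" "\<forall>x\<in>U \<inter> S. g x = f x"
    using assms by (auto simp: smooth_on_def)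
  have "isCont g p"
    using Cinf_on_continuous[OF U(3)] U(1,2) continuous_on_eq_continuous_at by blast
  then have "continuous (at p within S) g"
    by (rule continuous_at_imp_continuous_at_within)
  moreover have "\<forall>\<^sub>F x in at p within S. g x = f x"
    using U by (auto simp: eventually_at_topological)
  ultimately show "continuous (at p within S) f"
    using U(2,4) \<open>p \<in> S\<close> by (auto simp: continuous_within intro: Lim_transform_eventually)
qed

lemma sgn_in_sphere: "x \<noteq> 0 \<Longrightarrow> sgn x \<in> sphere 0 1" for x :: "'a::real_normed_vector"
  by (simp add: norm_sgn)

lemma Cinf_on_sgn: "Cinf_on (- {0::'a::euclidean_space}) sgn"
  unfolding sgn_div_norm
  by (intro Cinf_on_scaleR Cinf_on_inverse Cinf_on_norm Cinf_on_bounded_linear bounded_linear_ident)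
    auto

locale radial_function =
  fixes F :: "real ^ 3 \<Rightarrow> real"
  assumes smooth: "smooth_on (sphere 0 1) F"
    and pos: "\<omega> \<in> sphere 0 1 \<Longrightarrow> F \<omega> > 0"
begin

text \<open>The Minkowski functional of the star-shaped region bounded by the spatial projection
  of the surface.\<close>

definition star_gauge :: "real ^ 3 \<Rightarrow> real" where
  "star_gauge x = norm x / F (sgn x)"

definition body :: "(real ^ 3) set" where
  "body = {x. star_gauge x \<le> 1}"

lemma Cinf_on_radial_extension: "Cinf_on (- {0}) (\<lambda>x. F (sgn x))"
proof (rule Cinf_on_local)
  fix x :: "real ^ 3" assume x: "x \<in> - {0}"
  then have "x \<noteq> 0" by simp
  have "\<exists>U g. open U \<and> sgn x \<in> U \<and> Cinf_on U g \<and> (\<forall>\<omega>\<in>U \<inter> sphere 0 1. g \<omega> = F \<omega>)"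
    using bspec[OF smooth[unfolded smooth_on_def] sgn_in_sphere[OF \<open>x \<noteq> 0\<close>]] .
  then obtain U g where U: "open U" "sgn x \<in> U" "Cinf_on U g"
    "\<forall>\<omega>\<in>U \<inter> sphere 0 1. g \<omega> = F \<omega>"
    by (elim exE conjE) (rule that)
  let ?V = "sgn -` U \<inter> - {0} :: (real ^ 3) set"
  have "open ?V"
    using Cinf_on_continuous[OF Cinf_on_sgn] U(1)
    by (subst (asm) continuous_on_open_vimage) auto
  moreover have "Cinf_on ?V (\<lambda>x. g (sgn x))"
    by (rule Cinf_on_compose[OF \<open>open ?V\<close> U(1,3) Cinf_on_subset[OF Cinf_on_sgn]]) auto
  then have "Cinf_on ?V (\<lambda>x. F (sgn x))"
    by (rule Cinf_on_cong[THEN iffD1, rotated 2])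
      (use \<open>open ?V\<close> bspec[OF U(4)] in \<open>auto simp: norm_sgn\<close>)
  ultimately show "\<exists>V. open V \<and> x \<in> V \<and> Cinf_on V (\<lambda>x. F (sgn x))"
    using x U(2) by blast
qed

lemma F_sgn_pos: "x \<noteq> 0 \<Longrightarrow> F (sgn x) > 0"
  by (rule pos[OF sgn_in_sphere])

lemma Cinf_on_star_gauge: "Cinf_on (- {0}) star_gauge"
  unfolding star_gauge_def divide_inverse
  by (intro Cinf_on_mult Cinf_on_inverse Cinf_on_norm Cinf_on_radial_extension)
    (auto dest: F_sgn_pos)

lemma star_gauge_scaleR: "s \<ge> 0 \<Longrightarrow> star_gauge (s *\<^sub>R x) = s * star_gauge x"
  by (cases "s = 0") (auto simp: star_gauge_def sgn_scaleR)

lemma star_gauge_pos: "x \<noteq> 0 \<Longrightarrow> star_gauge x > 0"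
  by (simp add: star_gauge_def F_sgn_pos)

lemma star_gauge_0 [simp]: "star_gauge 0 = 0"
  by (simp add: star_gauge_def)

lemma star_gauge_nonneg: "star_gauge x \<ge> 0"
  by (cases "x = 0") (auto simp: less_imp_le star_gauge_pos)

lemma norm_eq_gauge: "norm x = star_gauge x * F (sgn x)"
  by (cases "x = 0") (auto simp: star_gauge_def dest: F_sgn_pos)

lemma F_bounds: "\<exists>m M. m > 0 \<and> (\<forall>\<omega>\<in>sphere 0 1. m \<le> F \<omega> \<and> F \<omega> \<le> M)"
proof -
  let ?S = "sphere 0 1 :: (real ^ 3) set"
  have S: "compact ?S" "?S \<noteq> {}" "continuous_on ?S F"
    using smooth_on_continuous[OF smooth] by auto
  obtain a where "a \<in> ?S" "\<forall>\<omega>\<in>?S. F a \<le> F \<omega>"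
    using continuous_attains_inf[OF S] by blast
  moreover obtain b where "b \<in> ?S" "\<forall>\<omega>\<in>?S. F \<omega> \<le> F b"
    using continuous_attains_sup[OF S] by blast
  ultimately show ?thesis using pos by blast
qed

lemma norm_ge_gauge: "\<exists>m>0. \<forall>x. m * star_gauge x \<le> norm x"
proof -
  obtain m M where m: "m > 0" "\<And>\<omega>. \<omega> \<in> sphere 0 1 \<Longrightarrow> m \<le> F \<omega> \<and> F \<omega> \<le> M"
    using F_bounds by blast
  have "m * star_gauge x \<le> norm x" for x
  proof (cases "x = 0")
    case False
    then show ?thesis
      using m(2)[OF sgn_in_sphere[OF False]] mult_right_mono[of m "F (sgn x)" "star_gauge x"]
      by (simp add: norm_eq_gauge[of x] star_gauge_nonneg mult.commute)
  qed simp
  then show ?thesis using m(1) by blast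
qed

text \<open>A smooth defining function of the body. Being constant near the origin, it does not see that the
  gauge is singular there.\<close>

definition bump :: "real ^ 3 \<Rightarrow> real" where
  "bump x = flat 0 (1 / 2) - flat 0 (star_gauge x - 1 / 2)"

lemma bump_pos_iff: "bump x > 0 \<longleftrightarrow> star_gauge x < 1"
  using flat_0_less_iff[of "1 / 2" "star_gauge x - 1 / 2"] by (simp add: bump_def)

lemma bump_nonneg_iff: "bump x \<ge> 0 \<longleftrightarrow> star_gauge x \<le> 1"
proof
  assume "bump x \<ge> 0"
  show "star_gauge x \<le> 1"
  proof (rule ccontr)
    assume "\<not> star_gauge x \<le> 1"
    then have "flat 0 (1 / 2) < flat 0 (star_gauge x - 1 / 2)"
      by (subst flat_0_less_iff) auto
    with \<open>bump x \<ge> 0\<close> show False by (simp add: bump_def)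
  qed
next
  assume "star_gauge x \<le> 1"
  then show "bump x \<ge> 0" using flat_0_mono[of "star_gauge x - 1 / 2" "1 / 2"] by (simp add: bump_def)
qed

lemma bump_gt: "bump x > - 1"
proof -
  have "flat 0 (1 / 2) > 0" by (simp add: flat_def)
  then show ?thesis using flat_0_le_1[of "star_gauge x - 1 / 2"] by (simp add: bump_def)
qed

lemma Cinf_on_bump: "Cinf_on UNIV bump"
proof (rule Cinf_on_local)
  fix x :: "real ^ 3"
  show "\<exists>V. open V \<and> x \<in> V \<and> Cinf_on V bump"
  proof (cases "x = 0")
    case True
    obtain m where m: "m > 0" "\<And>y. m * star_gauge y \<le> norm y" using norm_ge_gauge by blast
    have "bump y = flat 0 (1 / 2)" if "y \<in> ball 0 (m / 2)" for y
    proof -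
      have "m * star_gauge y < m * (1 / 2)" using m(2)[of y] that by simp
      then have "star_gauge y < 1 / 2" using m(1) mult_less_cancel_left_pos by blast
      then show ?thesis by (simp add: bump_def flat_def)
    qed
    then have "Cinf_on (ball 0 (m / 2)) bump"
      using Cinf_on_cong[of "ball 0 (m / 2)" bump "\<lambda>_. flat 0 (1 / 2)"] Cinf_on_const by simp
    then show ?thesis
      using True m(1) by (intro exI[of _ "ball 0 (m / 2)"]) auto
  next
    case False
    have "Cinf_on UNIV (flat 0)" by (simp add: Cinf_on_def Ck_on_flat)
    then have "Cinf_on (- {0}) (\<lambda>y. flat 0 (1 / 2) - flat 0 (star_gauge y - 1 / 2))"
      by (intro Cinf_on_diff Cinf_on_const Cinf_on_star_gauge
          Cinf_on_compose[of "- {0}" UNIV "flat 0"]) auto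
    then show ?thesis
      using False by (intro exI[of _ "- {0}"]) (auto simp: bump_def[abs_def])
  qed
qed

lemma compact_body: "compact body"
proof -
  obtain m M where mM: "m > 0" "\<And>\<omega>. \<omega> \<in> sphere 0 1 \<Longrightarrow> m \<le> F \<omega> \<and> F \<omega> \<le> M"
    using F_bounds by blast
  have "norm x \<le> \<bar>M\<bar>" if "x \<in> body" for x
  proof (cases "x = 0")
    case False
    have "star_gauge x * F (sgn x) \<le> 1 * \<bar>M\<bar>"
      using mM(2)[OF sgn_in_sphere[OF False]] that F_sgn_pos[OF False]
      by (intro mult_mono) (auto simp: body_def star_gauge_nonneg)
    then show ?thesis by (simp add: norm_eq_gauge[of x])
  qed simp
  then have "bounded body" by (auto simp: bounded_iff)
  moreover have "body = bump -` {0..}" by (auto simp: body_def bump_nonneg_iff)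
  then have "closed body"
    using Cinf_on_continuous[OF Cinf_on_bump] by (simp add: closed_vimage)
  ultimately show ?thesis by (simp add: compact_eq_bounded_closed)
qed

lemma interior_body: "star_gauge x < 1 \<Longrightarrow> x \<in> interior body"
proof (rule interiorI)
  show "open (bump -` {0<..})"
    using Cinf_on_continuous[OF Cinf_on_bump] by (simp add: open_vimage)
qed (auto simp: body_def bump_pos_iff)

text \<open>In coordinates in which \<open>x\<close> lies on the positive first axis, the gauge and the
  two projective coordinates \<open>z\<^sub>2/z\<^sub>1\<close>, \<open>z\<^sub>3/z\<^sub>1\<close> straighten the body. By homogeneity of the
  gauge, the inverse is explicit.\<close>

lemma body_boundary_chart:
  assumes "star_gauge x = 1"
  obtains W W' \<Phi> \<Psi> where "x \<in> W" "diffeomorphism W W' \<Phi> (\<Psi> :: real ^ 3 \<Rightarrow> real ^ 3)"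
    "\<Phi> ` (body \<inter> W) = {y\<in>W'. y $ 1 \<ge> 0}" "\<Phi> x $ 1 = 0"
proof -
  let ?e = "axis 1 1 :: real ^ 3"
  have "x \<noteq> 0" using assms by auto
  then have "norm ?e = norm (sgn x)" by (simp add: norm_axis_1 norm_sgn)
  then obtain A where A: "orthogonal_transformation A" "A ?e = sgn x"
    using orthogonal_transformation_exists by blast
  define B where "B = inv A"
  have lin: "linear A" "linear B"
    using A(1) orthogonal_transformation_inv[OF A(1)]
    by (auto simp: B_def orthogonal_transformation_def)
  have bl: "bounded_linear A" "bounded_linear B"
    using lin linear_conv_bounded_linear by blast+
  have AB: "A (B z) = z" "B (A z) = z" for z
    using orthogonal_transformation_bij[OF A(1)]
    by (simp_all add: B_def bij_is_inj bij_is_surj surj_f_inv_f)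
  define W where "W = {z. B z $ 1 > 0}"
  define W' where "W' = {y :: real ^ 3. y $ 1 < 1}"
  \<comment> \<open>\<open>d y\<close> has first coordinate 1 and recovers the direction of the preimage of \<open>y\<close>.\<close>
  define d where "d y = y + (1 - y $ 1) *\<^sub>R ?e" for y
  define \<Phi> where "\<Phi> z = inverse (B z $ 1) *\<^sub>R B z - star_gauge z *\<^sub>R ?e" for z
  define \<Psi> where "\<Psi> y = ((1 - y $ 1) * inverse (star_gauge (A (d y)))) *\<^sub>R A (d y)" for y
  have d1: "d y $ 1 = 1" for y by (simp add: d_def)
  have W0: "W \<subseteq> - {0}" by (auto simp: W_def linear_0[OF lin(2)])
  have Ad: "A (d y) \<noteq> 0" for y
    using AB(2)[of "d y"] d1[of y] by (auto simp: linear_0[OF lin(2)])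
  have blB1: "bounded_linear (\<lambda>z. B z $ 1)" and bl1: "bounded_linear (\<lambda>y :: real ^ 3. y $ 1)"
    using bounded_linear_compose[OF bounded_linear_vec_nth bl(2)] bounded_linear_vec_nth by auto
  have op: "open W" "open W'"
    unfolding W_def W'_def
    by (auto intro!: open_Collect_less continuous_intros linear_continuous_on blB1)
  have \<Phi>1: "\<Phi> z $ 1 = 1 - star_gauge z" if "z \<in> W" for z
    using that by (simp add: \<Phi>_def W_def)
  have \<Phi>W: "\<Phi> z \<in> W'" if "z \<in> W" for z
    using star_gauge_pos[of z] W0 that by (auto simp: W'_def \<Phi>1)
  have \<Psi>\<Phi>: "\<Psi> (\<Phi> z) = z" if "z \<in> W" for z
  proof -
    have z: "B z $ 1 > 0" "star_gauge z > 0" using that star_gauge_pos[of z] W0 by (auto simp: W_def)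
    have "d (\<Phi> z) = inverse (B z $ 1) *\<^sub>R B z"
      by (simp add: d_def \<Phi>1[OF that]) (simp add: \<Phi>_def)
    then have "A (d (\<Phi> z)) = inverse (B z $ 1) *\<^sub>R z"
      by (simp add: linear_scale[OF lin(1)] AB)
    then show ?thesis
      using z by (simp add: \<Psi>_def \<Phi>1[OF that] star_gauge_scaleR field_simps)
  qed
  have B\<Psi>: "B (\<Psi> y) = ((1 - y $ 1) * inverse (star_gauge (A (d y)))) *\<^sub>R d y" for y
    by (simp add: \<Psi>_def linear_scale[OF lin(2)] AB)
  have \<Psi>W: "\<Psi> y \<in> W" if "y \<in> W'" for y
    using that star_gauge_pos[OF Ad] by (simp add: W_def W'_def B\<Psi> d1)
  have \<Phi>\<Psi>: "\<Phi> (\<Psi> y) = y" if "y \<in> W'" for y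
  proof -
    have y: "1 - y $ 1 > 0" "star_gauge (A (d y)) > 0"
      using that star_gauge_pos[OF Ad] by (auto simp: W'_def)
    have "inverse (B (\<Psi> y) $ 1) *\<^sub>R B (\<Psi> y) = d y"
      using y by (simp add: B\<Psi> d1 field_simps)
    moreover have "star_gauge (\<Psi> y) = 1 - y $ 1"
      using y by (simp add: \<Psi>_def star_gauge_scaleR)
    ultimately show ?thesis by (simp add: \<Phi>_def d_def)
  qed
  have C\<Phi>: "Cinf_on W \<Phi>"
    unfolding \<Phi>_def
    by (intro Cinf_on_diff Cinf_on_scaleR Cinf_on_inverse op Cinf_on_const
        Cinf_on_bounded_linear bl blB1 Cinf_on_subset[OF Cinf_on_star_gauge W0]) (auto simp: W_def)
  have CAd: "Cinf_on W' (\<lambda>y. A (d y))"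
    unfolding d_def
    by (intro Cinf_on_linear_compose[OF op(2) bl(1)] Cinf_on_add Cinf_on_scaleR Cinf_on_diff
        op Cinf_on_const Cinf_on_bounded_linear bounded_linear_ident bl1)
  have CgAd: "Cinf_on W' (\<lambda>y. star_gauge (A (d y)))"
    by (rule Cinf_on_compose[OF op(2) _ Cinf_on_star_gauge CAd]) (use Ad in auto)
  have "star_gauge (A (d y)) \<noteq> 0" for y
    using star_gauge_pos[OF Ad[of y]] by simp
  then have C\<Psi>: "Cinf_on W' \<Psi>"
    unfolding \<Psi>_def
    by (intro Cinf_on_scaleR Cinf_on_mult Cinf_on_inverse Cinf_on_diff op Cinf_on_const CAd CgAd
        Cinf_on_bounded_linear[OF op(2) bl1])
  have "homeomorphism W W' \<Phi> \<Psi>"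
    by (rule homeomorphismI[OF Cinf_on_continuous[OF C\<Phi>] Cinf_on_continuous[OF C\<Psi>]])
      (auto simp: \<Phi>W \<Psi>W \<Phi>\<Psi> \<Psi>\<Phi>)
  then have "diffeomorphism W W' \<Phi> \<Psi>"
    using op C\<Phi> C\<Psi> by (simp add: diffeomorphism_def)
  moreover have "\<Phi> ` (body \<inter> W) = {y\<in>W'. y $ 1 \<ge> 0}"
  proof (intro equalityI subsetI)
    fix y assume y: "y \<in> {y\<in>W'. y $ 1 \<ge> 0}"
    then have "\<Psi> y \<in> body \<inter> W"
      using \<Phi>1[OF \<Psi>W, of y] \<Psi>W[of y] by (auto simp: body_def \<Phi>\<Psi>)
    then show "y \<in> \<Phi> ` (body \<inter> W)"
      using y \<Phi>\<Psi>[of y] by force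
  qed (auto simp: \<Phi>W \<Phi>1 body_def)
  moreover have "x \<in> W"
  proof -
    have "x = norm x *\<^sub>R A ?e" using \<open>x \<noteq> 0\<close> by (simp add: A(2) sgn_div_norm)
    then have "B x = norm x *\<^sub>R ?e" by (metis AB(2) linear_scale[OF lin(2)])
    then show ?thesis using \<open>x \<noteq> 0\<close> by (simp add: W_def)
  qed
  ultimately show thesis using that \<Phi>1[of x] assms by simp
qed

text \<open>By homogeneity of the gauge, differentiation along the ray through \<open>x\<close> only involves the
  one-dimensional profile.\<close>

lemma bump_radial_derivative:
  assumes "(bump has_derivative D) (at x)"
  shows "D x = - star_gauge x * flat 2 (star_gauge x - 1 / 2)"
proof -
  let ?r = "\<lambda>s. bump (s *\<^sub>R x)"
  have "((\<lambda>s. s *\<^sub>R x) has_derivative (\<lambda>s. s *\<^sub>R x)) (at (1::real))"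
    by (auto intro!: derivative_eq_intros)
  from has_derivative_compose[OF this, of bump D] assms
  have "(?r has_derivative (\<lambda>s. D (s *\<^sub>R x))) (at 1)" by simp
  then have D: "(?r has_real_derivative D x) (at 1)"
    using linear_scale[OF has_derivative_linear[OF assms]]
    by (simp add: has_field_derivative_def mult_commute_abs)
  have "((\<lambda>s. flat 0 (1 / 2) - flat 0 (s * star_gauge x - 1 / 2)) has_real_derivative
      - (flat 2 (1 * star_gauge x - 1 / 2) * star_gauge x)) (at 1)"
    by (auto intro!: derivative_eq_intros DERIV_chain'[OF _ flat_has_derivative] simp: numeral_2_eq_2)
  then have "(?r has_real_derivative - (flat 2 (1 * star_gauge x - 1 / 2) * star_gauge x)) (at 1)"
    by (rule has_field_derivative_transform_within_open[where S = "{0<..}"])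
      (auto simp: bump_def star_gauge_scaleR)
  from DERIV_unique[OF D this] show ?thesis by (simp add: mult.commute)
qed

abbreviation bump' :: "real ^ 3 \<Rightarrow> real ^ 3 \<Rightarrow> real" where
  "bump' x \<equiv> frechet_derivative bump (at x)"

lemma bump_has_derivative: "(bump has_derivative bump' x) (at x)"
  using Cinf_on_bump unfolding Cinf_on_def by (intro Ck_on_SucD[of 0 _ UNIV]) auto

lemma continuous_on_bump': "continuous_on A (\<lambda>x. bump' x v)"
proof -
  have "Ck_on (Suc 0) bump UNIV" using Cinf_on_bump unfolding Cinf_on_def by blast
  then show ?thesis by (auto intro: continuous_on_subset)
qed

definition bump_grad :: "real ^ 3 \<Rightarrow> real ^ 3" where
  "bump_grad x = (\<Sum>i\<in>Basis. bump' x i *\<^sub>R i)"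

lemma bump'_eq_inner: "bump' x v = bump_grad x \<bullet> v"
proof -
  have lin: "linear (bump' x)" using bump_has_derivative has_derivative_linear by blast
  have "bump' x v = bump' x (\<Sum>i\<in>Basis. (v \<bullet> i) *\<^sub>R i)"
    by (simp add: euclidean_representation)
  also have "\<dots> = bump_grad x \<bullet> v"
    by (simp add: linear_sum[OF lin] linear_scale[OF lin] bump_grad_def inner_sum_left
        inner_commute[of v] mult.commute)
  finally show ?thesis .
qed

text \<open>On the body the defining function exceeds its radial derivative: inside because it is positive and
  radially nonincreasing, on the boundary because it decreases strictly there.\<close>

lemma bump_minus_radial_pos:
  assumes "x \<in> body"
  shows "bump x - bump_grad x \<bullet> x > 0"
proof -
  have rad: "bump_grad x \<bullet> x = - star_gauge x * flat 2 (star_gauge x - 1 / 2)"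
    using bump_radial_derivative[OF bump_has_derivative] by (simp add: bump'_eq_inner)
  have flat: "flat 2 s \<ge> 0" for s by (simp add: flat_def)
  show ?thesis
  proof (cases "star_gauge x = 1")
    case True
    then show ?thesis unfolding rad by (simp add: bump_def flat_def)
  next
    case False
    then have "bump x > 0" using assms by (simp add: body_def bump_pos_iff)
    moreover have "star_gauge x * flat 2 (star_gauge x - 1 / 2) \<ge> 0"
      using flat star_gauge_nonneg by simp
    ultimately show ?thesis unfolding rad by simp
  qed
qed

text \<open>Lifting the light cone \<open>t\<^sup>2 = \<bar>x\<bar>\<^sup>2\<close> by a multiple of the defining function leaves it fixed over
  the boundary of the body and makes it smooth and, for small \<open>\<epsilon> > 0\<close>, spacelike over the whole body.\<close>

definition height :: "real \<Rightarrow> real ^ 3 \<Rightarrow> real" where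
  "height \<epsilon> x = sqrt (x \<bullet> x + \<epsilon> * bump x)"

lemma height_boundary: "star_gauge x = 1 \<Longrightarrow> height \<epsilon> x = norm x"
  by (simp add: height_def bump_def norm_eq_sqrt_inner)

lemma Cinf_on_height:
  assumes "\<And>x. x \<bullet> x + \<epsilon> * bump x > 0"
  shows "Cinf_on UNIV (height \<epsilon>)"
  unfolding height_def[abs_def]
  by (intro Cinf_on_sqrt Cinf_on_add Cinf_on_inner Cinf_on_mult Cinf_on_const Cinf_on_bump
      Cinf_on_bounded_linear bounded_linear_ident assms open_UNIV)

lemma height_has_derivative:
  assumes "x \<bullet> x + \<epsilon> * bump x > 0"
  shows "(height \<epsilon> has_derivative
    (\<lambda>v. ((x + (\<epsilon> / 2) *\<^sub>R bump_grad x) \<bullet> v) / height \<epsilon> x)) (at x)"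
  unfolding height_def[abs_def]
  by (rule derivative_eq_intros bump_has_derivative assms refl)+
    (use assms in \<open>auto simp: bump'_eq_inner inner_add_left inner_add_right inner_commute field_simps\<close>)

text \<open>Where \<open>G = \<epsilon> bump\<close>, the graph of \<open>sqrt (\<bar>x\<bar>\<^sup>2 + G)\<close> has slope less than 1 iff
  \<open>\<bar>x + \<nabla>G/2\<bar>\<^sup>2 < \<bar>x\<bar>\<^sup>2 + G\<close>.\<close>

lemma height_slope:
  assumes "x \<bullet> x + \<epsilon> * bump x > 0" and "\<epsilon> > 0"
    and "\<epsilon> * (norm (bump_grad x))\<^sup>2 / 4 < bump x - bump_grad x \<bullet> x" and "v \<noteq> 0"
  shows "(((x + (\<epsilon> / 2) *\<^sub>R bump_grad x) \<bullet> v) / height \<epsilon> x)\<^sup>2 < v \<bullet> v"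
proof -
  let ?n = "x + (\<epsilon> / 2) *\<^sub>R bump_grad x"
  have "?n \<bullet> ?n = x \<bullet> x + \<epsilon> * (bump_grad x \<bullet> x + \<epsilon> * (norm (bump_grad x))\<^sup>2 / 4)"
    by (simp add: algebra_simps inner_commute power2_norm_eq_inner)
  also have "\<dots> < x \<bullet> x + \<epsilon> * bump x"
    using assms(2,3) by (intro add_strict_left_mono mult_strict_left_mono) auto
  also have "\<dots> = (height \<epsilon> x)\<^sup>2"
    using assms(1) by (simp add: height_def)
  finally have n: "?n \<bullet> ?n < (height \<epsilon> x)\<^sup>2" .
  have "(?n \<bullet> v)\<^sup>2 \<le> (?n \<bullet> ?n) * (v \<bullet> v)" by (rule Cauchy_Schwarz_ineq)
  also have "\<dots> < (height \<epsilon> x)\<^sup>2 * (v \<bullet> v)"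
    using n assms(4) by (intro mult_strict_right_mono) auto
  finally show ?thesis
    using assms(1) by (simp add: power_divide height_def divide_simps mult.commute)
qed

text \<open>After division by \<open>\<epsilon>\<close> the slope condition compares a positive function with \<open>\<epsilon>\<close> times a bounded
  one, both continuous on the compact body. The second conclusion holds also off the body, where the
  defining function is negative, so that the height is smooth on all of \<open>\<real>\<^sup>3\<close>.\<close>

lemma small_height:
  obtains \<epsilon> where "\<epsilon> > 0" "\<And>x. x \<bullet> x + \<epsilon> * bump x > 0"
    "\<And>x. x \<in> body \<Longrightarrow> \<epsilon> * (norm (bump_grad x))\<^sup>2 / 4 < bump x - bump_grad x \<bullet> x"
proof -
  have cont: "continuous_on body bump_grad" "continuous_on body bump"
    unfolding bump_grad_def[abs_def]
    by (intro continuous_intros continuous_on_bump')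
      (rule continuous_on_subset[OF Cinf_on_continuous[OF Cinf_on_bump]], simp)
  have ne: "body \<noteq> {}"
    using star_gauge_0 by (auto simp: body_def intro!: exI[of _ 0])
  have "continuous_on body (\<lambda>x. bump x - bump_grad x \<bullet> x)"
    using cont by (intro continuous_intros)
  then obtain a where a: "a \<in> body"
    "\<And>x. x \<in> body \<Longrightarrow> bump a - bump_grad a \<bullet> a \<le> bump x - bump_grad x \<bullet> x"
    using continuous_attains_inf[OF compact_body ne] by blast
  have "continuous_on body (\<lambda>x. (norm (bump_grad x))\<^sup>2 / 4)"
    using cont by (intro continuous_intros) auto
  then obtain b where b: "\<And>x. x \<in> body \<Longrightarrow> (norm (bump_grad x))\<^sup>2 / 4 \<le> (norm (bump_grad b))\<^sup>2 / 4"
    using continuous_attains_sup[OF compact_body ne] by blast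
  obtain m where m: "m > 0" "\<And>x. m * star_gauge x \<le> norm x" using norm_ge_gauge by blast
  define p where "p = bump a - bump_grad a \<bullet> a"
  define q where "q = (norm (bump_grad b))\<^sup>2 / 4"
  \<comment> \<open>The bound \<open>m\<^sup>2\<close> serves points off the body: there \<open>m \<le> norm x\<close> and \<open>bump x > -1\<close>.\<close>
  define \<epsilon> where "\<epsilon> = min (p / (q + 1)) (m\<^sup>2)"
  have pq: "p > 0" "q \<ge> 0" using bump_minus_radial_pos[OF a(1)] by (auto simp: p_def q_def)
  then have "\<epsilon> > 0" using m(1) by (simp add: \<epsilon>_def)
  moreover have "x \<bullet> x + \<epsilon> * bump x > 0" for x
  proof (cases "bump x > 0")
    case True
    then show ?thesis using \<open>\<epsilon> > 0\<close> by (simp add: add_nonneg_pos)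
  next
    case False
    then have "star_gauge x \<ge> 1" by (simp add: bump_pos_iff)
    then have "m \<le> norm x"
      using m(2)[of x] mult_left_mono[of 1 "star_gauge x" m] m(1) by (smt (verit) mult.right_neutral)
    then have "m\<^sup>2 \<le> x \<bullet> x"
      using power_mono[of m "norm x" 2] m(1) by (simp add: dot_square_norm)
    then have "\<epsilon> \<le> x \<bullet> x" by (simp add: \<epsilon>_def)
    moreover have "\<epsilon> * bump x > - \<epsilon>"
      using mult_strict_left_mono[OF bump_gt \<open>\<epsilon> > 0\<close>, of x] by simp
    ultimately show ?thesis by linarith
  qed
  moreover have "\<epsilon> * (norm (bump_grad x))\<^sup>2 / 4 < bump x - bump_grad x \<bullet> x" if "x \<in> body" for x
  proof -
    have "\<epsilon> * ((norm (bump_grad x))\<^sup>2 / 4) \<le> \<epsilon> * q"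
      using b[OF that] \<open>\<epsilon> > 0\<close> by (simp add: q_def)
    also have "\<dots> \<le> p / (q + 1) * q"
      using pq by (intro mult_right_mono) (auto simp: \<epsilon>_def)
    also have "\<dots> < p" using pq by (simp add: field_simps)
    also have "p \<le> bump x - bump_grad x \<bullet> x" using a(2)[OF that] by (simp add: p_def)
    finally show ?thesis by simp
  qed
  ultimately show thesis using that by blast
qed

lemma light_cone_surface_eq: "light_cone_surface F = {(norm x, x) | x. star_gauge x = 1}"
proof (intro equalityI subsetI)
  fix p assume "p \<in> light_cone_surface F"
  then obtain \<omega> where \<omega>: "\<omega> \<in> sphere 0 1" "p = (F \<omega>, F \<omega> *\<^sub>R \<omega>)"
    by (auto simp: light_cone_surface_def)
  then have "sgn \<omega> = \<omega>" "F \<omega> > 0" by (auto simp: sgn_div_norm pos)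
  then have "star_gauge (F \<omega> *\<^sub>R \<omega>) = 1" "norm (F \<omega> *\<^sub>R \<omega>) = F \<omega>"
    using \<omega>(1) by (auto simp: star_gauge_scaleR) (simp add: star_gauge_def)
  then show "p \<in> {(norm x, x) | x. star_gauge x = 1}" using \<omega>(2) by force
next
  fix p assume "p \<in> {(norm x, x) | x. star_gauge x = 1}"
  then obtain x where x: "p = (norm x, x)" "star_gauge x = 1" by blast
  then have "x \<noteq> 0" by auto
  moreover have "norm x = F (sgn x)" using norm_eq_gauge[of x] x(2) by simp
  moreover have "x = norm x *\<^sub>R sgn x" using \<open>x \<noteq> 0\<close> by (simp add: sgn_div_norm)
  ultimately show "p \<in> light_cone_surface F"
    using x(1) sgn_in_sphere[of x] unfolding light_cone_surface_def by auto
qed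

text \<open>For \<open>p = a (1, \<omega>)\<close> and \<open>q = b (1, \<omega>')\<close> the displacement satisfies
  \<open>\<eta>(q - p, q - p) = 2 a b (1 - \<langle>\<omega>, \<omega>'\<rangle>) = a b \<bar>\<omega> - \<omega>'\<bar>\<^sup>2\<close>.\<close>

lemma acausal_light_cone_surface: "acausal (light_cone_surface F)"
  unfolding acausal_def
proof (intro ballI impI notI)
  fix p q
  assume "p \<in> light_cone_surface F" "q \<in> light_cone_surface F" and ne: "p \<noteq> q"
    and rel: "causally_related p q"
  then obtain \<omega> \<omega>' where p: "\<omega> \<in> sphere 0 1" "p = (F \<omega>, F \<omega> *\<^sub>R \<omega>)"
    and q: "\<omega>' \<in> sphere 0 1" "q = (F \<omega>', F \<omega>' *\<^sub>R \<omega>')"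
    by (auto simp: light_cone_surface_def)
  have "eta (q - p) (q - p) \<le> 0"
    using rel causal_path_displacement
    by (auto simp: causally_related_def pathstart_def pathfinish_def)
  moreover have "eta (q - p) (q - p) = F \<omega> * F \<omega>' * ((\<omega> - \<omega>') \<bullet> (\<omega> - \<omega>'))"
    using p(1) q(1)
    by (simp add: p(2) q(2) eta_def norm_eq_1 algebra_simps inner_commute)
  moreover have "(\<omega> - \<omega>') \<bullet> (\<omega> - \<omega>') > 0" using ne p(2) q(2) by auto
  then have "F \<omega> * F \<omega>' * ((\<omega> - \<omega>') \<bullet> (\<omega> - \<omega>')) > 0"
    using pos p(1) q(1) by simp
  ultimately show False by simp
qed

lemma light_cone_surface_spans:
  "\<exists>H. compact H \<and> spacelike_hypersurface H \<and> spans (light_cone_surface F) H"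
proof -
  obtain \<epsilon> where \<epsilon>: "\<epsilon> > 0" "\<And>x. x \<bullet> x + \<epsilon> * bump x > 0"
    "\<And>x. x \<in> body \<Longrightarrow> \<epsilon> * (norm (bump_grad x))\<^sup>2 / 4 < bump x - bump_grad x \<bullet> x"
    using small_height by blast
  define h where "h = height \<epsilon>"
  define H where "H = graph_over h body"
  have h: "Cinf_on UNIV h" unfolding h_def using \<epsilon>(2) by (rule Cinf_on_height)
  note cont = Cinf_on_continuous[OF h]
  have "compact H"
    unfolding H_def graph_over_def
    by (intro compact_continuous_image compact_body continuous_intros continuous_on_subset[OF cont])
      auto
  have boundary: "boundary_point H (h x, x)" if "star_gauge x = 1" for x
  proof -
    obtain W W' and \<Phi> \<Psi> :: "real ^ 3 \<Rightarrow> real ^ 3" where "x \<in> W" "diffeomorphism W W' \<Phi> \<Psi>"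
      "\<Phi> ` (body \<inter> W) = {y\<in>W'. y $ 1 \<ge> 0}" "\<Phi> x $ 1 = 0"
      using body_boundary_chart[OF \<open>star_gauge x = 1\<close>] by blast
    with h show ?thesis
      unfolding H_def using that
      by (intro boundary_point_graph_over[where W = W and \<Phi> = \<Phi>]) (auto simp: body_def)
  qed
  have interior: "interior_point H (h x, x)" "\<not> boundary_point H (h x, x)" if "star_gauge x < 1" for x
    unfolding H_def
    using interior_point_graph_over[OF h interior_body[OF that]]
      not_boundary_point_graph_over[OF cont interior_body[OF that]] by auto
  have HE: "\<exists>x. p = (h x, x) \<and> x \<in> body \<and> (star_gauge x = 1 \<or> star_gauge x < 1)" if "p \<in> H" for p
    using that by (auto simp: H_def graph_over_def body_def)
  have "hypersurface H"
    unfolding hypersurface_def using HE boundary interior(1) by blast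
  moreover have "spacelike v" if p: "p \<in> H" and v: "v \<in> tangent_space H p" "v \<noteq> 0" for p v
  proof -
    obtain x where x: "p = (h x, x)" "x \<in> body" using HE[OF p] by blast
    have "fst v = ((x + (\<epsilon> / 2) *\<^sub>R bump_grad x) \<bullet> snd v) / h x"
      using tangent_space_graph_over[OF height_has_derivative[OF \<epsilon>(2)]] v(1)
      unfolding H_def h_def x(1) by blast
    moreover from this have "snd v \<noteq> 0" using v(2) by (auto simp: prod_eq_iff)
    ultimately have "(fst v)\<^sup>2 < snd v \<bullet> snd v"
      using height_slope[OF \<epsilon>(2,1) \<epsilon>(3)[OF x(2)]] by (simp add: h_def)
    then show ?thesis by (simp add: spacelike_def eta_def power2_eq_square)
  qed
  ultimately have "spacelike_hypersurface H"
    unfolding spacelike_hypersurface_def by blast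
  moreover have "hypersurface_boundary H = {(h x, x) | x. star_gauge x = 1}"
    unfolding hypersurface_boundary_def
  proof (intro equalityI subsetI)
    fix p assume "p \<in> {p. boundary_point H p}"
    then have b: "boundary_point H p" "p \<in> H" by (auto simp: boundary_point_def)
    then show "p \<in> {(h x, x) | x. star_gauge x = 1}"
      using HE[OF b(2)] interior(2) by blast
  qed (use boundary in blast)
  then have "spans (light_cone_surface F) H"
    unfolding spans_def light_cone_surface_eq by (force simp: h_def height_boundary)
  ultimately show ?thesis using \<open>compact H\<close> by blast
qed

end

theorem mainTheorem5:
  fixes F :: "real ^ 3 \<Rightarrow> real"
  assumes "smooth_on (sphere 0 1) F"
    and "\<forall>\<omega>\<in>sphere 0 1. F \<omega> > 0"
  shows "acausal (light_cone_surface F) \<and>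
    (\<exists>H. compact H \<and> spacelike_hypersurface H \<and> spans (light_cone_surface F) H)"
proof -
  interpret radial_function F
    using assms by unfold_locales auto
  show ?thesis
    using acausal_light_cone_surface light_cone_surface_spans by blast
qed

end
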